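(* Let $\rho$ be an arbitrary two-qubit density operator, written as $$\rho=\frac14\Big[\mathbb{I}_2\otimes\mathbb{I}_2+\vec a\cdot\vec\sigma\otimes\mathbb{I}_2+\mathbb{I}_2\otimes\vec b\cdot\vec\sigma+\sum_{m=1}^{3}\sum_{n=1}^{3}t_{mn}\,\sigma_m\otimes\sigma_n\Big]$$ with $\vec a,\vec b\in\mathbb{R}^3$ and $t_{mn}\in\mathbb{R}$. Then $\rho$ is $F_3$ steerable if and only if its conditional Rényi 2-entropy satisfies $$S_2(A|B)_\rho<\log\left[\frac{1+\|\vec b\|^2}{1+\frac{\|\vec a\|^2+\|\vec b\|^2}{2}}\right].$$
   Context: $\sigma_1,\sigma_2,\sigma_3$ are the Pauli matrices and $\vec\sigma=(\sigma_1,\sigma_2,\sigma_3)$; $\|\cdot\|$ is the Euclidean norm; logarithms are to base 2. A density operator is a positive semidefinite operator of unit trace. The first tensor factor is system $A$ and the second is system $B$. $F_3$ steerability (violation of the three-settings CJWR steering inequality): for unit vectors $\hat u_1,\hat u_2,\hat u_3\in\mathbb{R}^3$ and orthonormal vectors $\hat v_1,\hat v_2,\hat v_3\in\mathbb{R}^3$, write $\nu=\{\hat u_1,\hat u_2,\hat u_3,\hat v_1,\hat v_2,\hat v_3\}$, $A_l=\hat u_l\cdot\vec\sigma$, $B_l=\hat v_l\cdot\vec\sigma$, and $$F_3(\rho,\nu)=\frac{1}{\sqrt3}\Big|\sum_{l=1}^{3}\mathrm{Tr}\big(\rho\,(A_l\otimes B_l)\big)\Big|.$$ The CJWR inequality is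 $F_3(\rho,\nu)\le 1$. The state $\rho$ is called $F_3$ steerable if $F_3(\rho,\nu)>1$ for some choice of such $\nu$, and $F_3$ unsteerable otherwise. Rényi 2-entropy: $S_2(\rho)=-\log\mathrm{Tr}(\rho^2)$. Conditional Rényi 2-entropy: $S_2(A|B)_\rho=S_2(\rho)-S_2(\rho_B)$, where $\rho_B=\mathrm{Tr}_A\rho$. *)

theory Defs
  imports "HOL-Analysis.Analysis"
begin

type_synonym qubit_op = "complex ^ 2 ^ 2"

text \<open>The index type \<^typ>\<open>2 \<times> 2\<close> lists the basis vectors \<open>|i\<rangle> \<otimes> |k\<rangle>\<close>;
  the first component belongs to system \<open>A\<close>, the second to system \<open>B\<close>.\<close>

type_synonym two_qubit_op = "complex ^ (2 \<times> 2) ^ (2 \<times> 2)"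

definition tensor_op :: "qubit_op \<Rightarrow> qubit_op \<Rightarrow> two_qubit_op" (infixl "\<otimes>\<^sub>q" 75) where
  "X \<otimes>\<^sub>q Y = (\<chi> i j. X $ fst i $ fst j * Y $ snd i $ snd j)"

definition ptrace_A :: "two_qubit_op \<Rightarrow> qubit_op" where
  "ptrace_A \<rho> = (\<chi> k l. \<Sum>i\<in>UNIV. \<rho> $ (i, k) $ (i, l))"

definition hermitian_op :: "complex ^ 'n ^ 'n \<Rightarrow> bool" where
  "hermitian_op M \<longleftrightarrow> (\<forall>i j. M $ i $ j = cnj (M $ j $ i))"

definition psd_op :: "complex ^ 'n::finite ^ 'n \<Rightarrow> bool" where
  "psd_op M \<longleftrightarrow> hermitian_op M \<and>
     (\<forall>x. 0 \<le> Re (\<Sum>i\<in>UNIV. cnj (x $ i) * (M *v x) $ i))"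

definition density_op :: "complex ^ 'n::finite ^ 'n \<Rightarrow> bool" where
  "density_op \<rho> \<longleftrightarrow> psd_op \<rho> \<and> trace \<rho> = 1"

text \<open>The library function \<^const>\<open>vector\<close> numbers entries from 1.
  In the index type \<^typ>\<open>3\<close> the last case below is \<open>3\<close> (which equals \<open>0\<close>).\<close>

definition pauli :: "3 \<Rightarrow> qubit_op" where
  "pauli m =
     (if m = 1 then vector [vector [0, 1], vector [1, 0]]
      else if m = 2 then vector [vector [0, - \<i>], vector [\<i>, 0]]
      else vector [vector [1, 0], vector [0, - 1]])"

definition pauli_dot :: "real ^ 3 \<Rightarrow> qubit_op" where
  "pauli_dot u = (\<Sum>m\<in>UNIV. u $ m *\<^sub>R pauli m)"

definition bloch_op :: "real ^ 3 \<Rightarrow> real ^ 3 \<Rightarrow> real ^ 3 ^ 3 \<Rightarrow> two_qubit_op" where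
  "bloch_op a b t = (1 / 4) *\<^sub>R
     (mat 1 \<otimes>\<^sub>q mat 1 + pauli_dot a \<otimes>\<^sub>q mat 1 + mat 1 \<otimes>\<^sub>q pauli_dot b
      + (\<Sum>m\<in>UNIV. \<Sum>n\<in>UNIV. t $ m $ n *\<^sub>R (pauli m \<otimes>\<^sub>q pauli n)))"

definition F3 :: "two_qubit_op \<Rightarrow> (3 \<Rightarrow> real ^ 3) \<Rightarrow> (3 \<Rightarrow> real ^ 3) \<Rightarrow> real" where
  "F3 \<rho> u v = 1 / sqrt 3 *
     cmod (\<Sum>l\<in>UNIV. trace (\<rho> ** (pauli_dot (u l) \<otimes>\<^sub>q pauli_dot (v l))))"

definition F3_steerable :: "two_qubit_op \<Rightarrow> bool" where
  "F3_steerable \<rho> \<longleftrightarrow>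
     (\<exists>u v. (\<forall>l. norm (u l) = 1) \<and>
            (\<forall>l m. v l \<bullet> v m = (if l = m then 1 else 0)) \<and>
            F3 \<rho> u v > 1)"

text \<open>For Hermitian \<open>\<rho>\<close> the trace of \<open>\<rho>\<^sup>2\<close> is real, so \<^const>\<open>Re\<close> only changes the type.\<close>

definition renyi2 :: "complex ^ 'n::finite ^ 'n \<Rightarrow> real" where
  "renyi2 \<rho> = - log 2 (Re (trace (\<rho> ** \<rho>)))"

definition cond_renyi2 :: "two_qubit_op \<Rightarrow> real" where
  "cond_renyi2 \<rho> = renyi2 \<rho> - renyi2 (ptrace_A \<rho>)"

text \<open>The form \<^const>\<open>bloch_op\<close> is no restriction: every two-qubit density operator has it.\<close>

lemma UNIV_22: "(UNIV::(2\<times>2) set) = {(1,1),(1,2),(2,1),(2,2)}"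
  using exhaust_2 by auto

lemma all_22: "(\<forall>i::2\<times>2. P i) \<longleftrightarrow> P (1,1) \<and> P (1,2) \<and> P (2,1) \<and> P (2,2)"
  by (simp add: split_paired_all forall_2 split: prod.splits)

lemma pauli_entries: "pauli 1 $ 1 $ 1 = 0" "pauli 1 $ 1 $ 2 = 1" "pauli 1 $ 2 $ 1 = 1" "pauli 1 $ 2 $ 2 = 0"
 "pauli 2 $ 1 $ 1 = 0" "pauli 2 $ 1 $ 2 = -\<i>" "pauli 2 $ 2 $ 1 = \<i>" "pauli 2 $ 2 $ 2 = 0"
 "pauli 3 $ 1 $ 1 = 1" "pauli 3 $ 1 $ 2 = 0" "pauli 3 $ 2 $ 1 = 0" "pauli 3 $ 2 $ 2 = -1"
  by (simp_all add: pauli_def)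

lemma density_op_has_bloch_form:
  assumes "density_op \<rho>"
  shows "\<exists>a b t. \<rho> = bloch_op a b t"
proof -
  let ?a = "\<chi> m. Re (trace (\<rho> ** (pauli m \<otimes>\<^sub>q mat 1)))"
  let ?b = "\<chi> m. Re (trace (\<rho> ** (mat 1 \<otimes>\<^sub>q pauli m)))"
  let ?t = "\<chi> m n. Re (trace (\<rho> ** (pauli m \<otimes>\<^sub>q pauli n)))"
  have h: "\<And>i j. \<rho> $ i $ j = cnj (\<rho> $ j $ i)" and tr: "trace \<rho> = 1"
    using assms unfolding density_op_def psd_op_def hermitian_op_def by blast+
  have hr: "\<And>i j. Re (\<rho> $ i $ j) = Re (\<rho> $ j $ i)" "\<And>i j. Im (\<rho> $ i $ j) = - Im (\<rho> $ j $ i)"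
    by (subst h, simp)+
  have d: "\<And>i. Im (\<rho> $ i $ i) = 0" using hr(2) by (metis equal_neg_zero)
  have tr': "Re (\<rho>$(1,1)$(1,1)) + Re(\<rho>$(1,2)$(1,2)) + Re(\<rho>$(2,1)$(2,1)) + Re (\<rho>$(2,2)$(2,2)) = 1"
    using arg_cong[OF tr, of Re] by (simp add: trace_def UNIV_22)
  have "\<rho> = bloch_op ?a ?b ?t"
    unfolding vec_eq_iff all_22
    apply (simp add: bloch_op_def tensor_op_def pauli_dot_def sum_3 pauli_entries trace_def matrix_matrix_mult_def UNIV_22 mat_def complex_eq_iff d)
    using tr' 
      hr(1)[of "(1,2)" "(1,1)"] hr(1)[of "(2,1)" "(1,1)"] hr(1)[of "(2,2)" "(1,1)"] hr(1)[of "(2,1)" "(1,2)"] hr(1)[of "(2,2)" "(1,2)"] hr(1)[of "(2,2)" "(2,1)"]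
      hr(2)[of "(1,2)" "(1,1)"] hr(2)[of "(2,1)" "(1,1)"] hr(2)[of "(2,2)" "(1,1)"] hr(2)[of "(2,1)" "(1,2)"] hr(2)[of "(2,2)" "(1,2)"] hr(2)[of "(2,2)" "(2,1)"]
    by (simp add: algebra_simps)
  thus ?thesis by blast
qed

end

theory Submission
  imports Defs
begin

text \<open>In Bloch form the correlation terms are \<open>u\<^sub>l \<bullet> T v\<^sub>l\<close>. By Cauchy-Schwarz their sum is at
  most \<open>\<Sum>\<^sub>l \<parallel>T v\<^sub>l\<parallel> \<le> \<surd>3 \<parallel>T\<parallel>\<close> with the Frobenius norm, and equality is attained at an
  orthonormal basis on which \<open>\<parallel>T v\<^sub>l\<parallel>\<close> is constant. Such a basis is found by repeatedly rotating
  two basis vectors in their plane until one of them takes the mean value. So \<open>\<rho>\<close> is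
  \<open>F\<^sub>3\<close> steerable iff \<open>\<parallel>T\<parallel> > 1\<close>; the entropy inequality says the same because
  \<open>Tr \<rho>\<^sup>2 = (1 + \<parallel>a\<parallel>\<^sup>2 + \<parallel>b\<parallel>\<^sup>2 + \<parallel>T\<parallel>\<^sup>2) / 4\<close> and \<open>Tr \<rho>\<^sub>B\<^sup>2 = (1 + \<parallel>b\<parallel>\<^sup>2) / 2\<close>.\<close>

section \<open>Orthonormal bases and the Frobenius norm\<close>

definition orthonormal :: "('n \<Rightarrow> real ^ 'm) \<Rightarrow> bool" where
  "orthonormal v \<longleftrightarrow> (\<forall>l m. v l \<bullet> v m = (if l = m then 1 else 0))"

lemma norm_vec_square:
  fixes x :: "'a::real_inner ^ 'n"
  shows "(norm x)\<^sup>2 = (\<Sum>i\<in>UNIV. (norm (x $ i))\<^sup>2)"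
  by (simp add: power2_norm_eq_inner inner_vec_def)

text \<open>Parseval applied to each row of \<open>t\<close>: the numbers
  \<open>t $ m \<bullet> v l\<close> are the coordinates of row \<open>m\<close> in the basis
  \<open>v\<close>. The norm of a matrix here is the Frobenius norm.\<close>

lemma sum_norm_orthonormal:
  fixes t :: "real ^ 'n ^ 'm" and v :: "'n \<Rightarrow> real ^ 'n"
  assumes "orthonormal v"
  shows "(\<Sum>l\<in>UNIV. (norm (t *v v l))\<^sup>2) = (norm t)\<^sup>2"
proof -
  define V :: "real ^ 'n ^ 'n" where "V = (\<chi> l. v l)"
  have "V ** transpose V = mat 1"
    using assms
    by (simp add: V_def orthonormal_def vec_eq_iff matrix_matrix_mult_def transpose_def mat_def
        inner_vec_def)
  \<comment> \<open>There are as many vectors as dimensions, so \<open>V\<close> is square and its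
    right inverse is also a left inverse.\<close>
  hence "orthogonal_matrix V"
    by (simp add: orthogonal_matrix_def matrix_left_right_inverse)
  hence V: "norm (V *v x) = norm x" for x
    by (metis matrix_of_matrix_vector_mul matrix_vector_mul_linear orthogonal_transformation
        orthogonal_transformation_matrix)
  have "(norm (t $ m))\<^sup>2 = (\<Sum>l\<in>UNIV. (t $ m \<bullet> v l)\<^sup>2)" for m
  proof -
    have "(V *v (t $ m)) $ l = t $ m \<bullet> v l" for l
      by (simp add: matrix_vector_mult_def V_def inner_vec_def mult.commute)
    thus ?thesis using norm_vec_square[of "V *v (t $ m)"] by (simp add: V)
  qed
  moreover have "(norm (t *v v l))\<^sup>2 = (\<Sum>m\<in>UNIV. (t $ m \<bullet> v l)\<^sup>2)" for l
    unfolding norm_vec_square[of "t *v v l"] by (simp add: matrix_vector_mult_def inner_vec_def)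
  ultimately show ?thesis
    using sum.swap[of "\<lambda>l m. (t $ m \<bullet> v l)\<^sup>2" UNIV UNIV] by (simp add: norm_vec_square[of t])
qed

text \<open>Turning \<open>v i\<close> towards \<open>v j\<close> moves the squared image norm
  continuously from its value at \<open>i\<close> to its value at \<open>j\<close>, so some angle
  gives \<open>c\<close>. All other vectors stay fixed, so values already equal to \<open>c\<close>
  elsewhere survive.\<close>

lemma orthonormal_rotate:
  fixes t :: "real ^ 'n ^ 'm" and v :: "'k \<Rightarrow> real ^ 'n"
  assumes v: "orthonormal v" and ij: "i \<noteq> j"
    and lo: "(norm (t *v v i))\<^sup>2 \<le> c" and hi: "c \<le> (norm (t *v v j))\<^sup>2"
  obtains w where "orthonormal w" "\<And>k. k \<noteq> i \<Longrightarrow> k \<noteq> j \<Longrightarrow> w k = v k"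
    "(norm (t *v w i))\<^sup>2 = c"
proof -
  define f where "f = (\<lambda>s::real. (norm (t *v (cos s *\<^sub>R v i + sin s *\<^sub>R v j)))\<^sup>2)"
  have "continuous_on {0..pi/2} f"
    unfolding f_def matrix_vector_right_distrib matrix_vector_mult_scaleR
    by (intro continuous_intros)
  moreover have "f 0 \<le> c" "c \<le> f (pi/2)" using lo hi by (simp_all add: f_def)
  ultimately obtain s where s: "f s = c"
    using IVT'[of f 0 c "pi/2"] by auto
  define w where "w = v(i := cos s *\<^sub>R v i + sin s *\<^sub>R v j, j := - sin s *\<^sub>R v i + cos s *\<^sub>R v j)"
  have vv: "v l \<bullet> v m = (if l = m then 1 else 0)" for l m
    using v by (simp add: orthonormal_def)
  have cs: "cos s * cos s + sin s * sin s = 1"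
    using sin_cos_squared_add2[of s] by (simp add: power2_eq_square)
  have "orthonormal w"
    unfolding orthonormal_def
    using ij cs by (auto simp: w_def vv inner_simps algebra_simps)
  moreover have "(norm (t *v w i))\<^sup>2 = c" using s ij by (simp add: w_def f_def)
  ultimately show thesis using that[of w] by (simp add: w_def)
qed

text \<open>Extremal argument: take an orthonormal basis with the most indices at the mean value
  \<open>c\<close>. If one index misses \<open>c\<close>, the fixed sum forces one value below and
  one above; rotating that pair gains an index, against maximality.\<close>

lemma orthonormal_equal_norms:
  fixes t :: "real ^ 'n ^ 'm"
  obtains v :: "'n \<Rightarrow> real ^ 'n" where "orthonormal v"
    "\<And>l. (norm (t *v v l))\<^sup>2 = (norm t)\<^sup>2 / CARD('n)"
proof -
  define c where "c = (norm t)\<^sup>2 / CARD('n)"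
  define N where "N = (\<lambda>v::'n \<Rightarrow> real ^ 'n. card {l. (norm (t *v v l))\<^sup>2 = c})"
  have "orthonormal (\<lambda>l. axis l 1 :: real ^ 'n)"
    by (simp add: orthonormal_def inner_axis_axis)
  moreover have "N v < Suc CARD('n)" for v
    unfolding N_def less_Suc_eq_le by (intro card_mono) auto
  ultimately obtain v where v: "orthonormal v" and max: "\<And>w. orthonormal w \<Longrightarrow> N w \<le> N v"
    using ex_has_greatest_nat[of orthonormal _ N "Suc CARD('n)"] by (metis (no_types, lifting))
  have sum: "(\<Sum>l\<in>UNIV. (norm (t *v v l))\<^sup>2) = (\<Sum>l\<in>(UNIV::'n set). c)"
    by (simp add: sum_norm_orthonormal[OF v] c_def)
  have "(norm (t *v v l))\<^sup>2 = c" for l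
  proof (rule ccontr)
    assume ne: "(norm (t *v v l))\<^sup>2 \<noteq> c"
    have "\<exists>i. (norm (t *v v i))\<^sup>2 < c"
    proof (rule ccontr)
      assume "\<not> ?thesis"
      hence ge: "c \<le> (norm (t *v v k))\<^sup>2" for k by (simp add: not_less)
      with ne have "c < (norm (t *v v l))\<^sup>2" using order.not_eq_order_implies_strict by metis
      hence "(\<Sum>l\<in>(UNIV::'n set). c) < (\<Sum>l\<in>UNIV. (norm (t *v v l))\<^sup>2)"
        using ge by (intro sum_strict_mono_ex1) auto
      thus False using sum by simp
    qed
    moreover have "\<exists>j. c < (norm (t *v v j))\<^sup>2"
    proof (rule ccontr)
      assume "\<not> ?thesis"
      hence le: "(norm (t *v v k))\<^sup>2 \<le> c" for k by (simp add: not_less)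
      with ne have "(norm (t *v v l))\<^sup>2 < c" using order.not_eq_order_implies_strict by metis
      hence "(\<Sum>l\<in>UNIV. (norm (t *v v l))\<^sup>2) < (\<Sum>l\<in>(UNIV::'n set). c)"
        using le by (intro sum_strict_mono_ex1) auto
      thus False using sum by simp
    qed
    ultimately obtain i j where i: "(norm (t *v v i))\<^sup>2 < c" and j: "c < (norm (t *v v j))\<^sup>2"
      by blast
    hence "i \<noteq> j" by auto
    then obtain w where w: "orthonormal w" "\<And>k. k \<noteq> i \<Longrightarrow> k \<noteq> j \<Longrightarrow> w k = v k"
        "(norm (t *v w i))\<^sup>2 = c"
      using orthonormal_rotate[OF v _ less_imp_le[OF i] less_imp_le[OF j]] by blast
    \<comment> \<open>Neither \<open>i\<close> nor \<open>j\<close> was at the mean before, so no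
      index is lost even if \<open>j\<close> misses it again, and \<open>i\<close> is
      gained.\<close>
    have "{l. (norm (t *v v l))\<^sup>2 = c} \<subset> {l. (norm (t *v w l))\<^sup>2 = c}"
    proof
      show "{l. (norm (t *v v l))\<^sup>2 = c} \<subseteq> {l. (norm (t *v w l))\<^sup>2 = c}"
      proof
        fix k assume k: "k \<in> {l. (norm (t *v v l))\<^sup>2 = c}"
        hence "k \<noteq> i" "k \<noteq> j" using i j by auto
        thus "k \<in> {l. (norm (t *v w l))\<^sup>2 = c}" using k w(2) by simp
      qed
      show "{l. (norm (t *v v l))\<^sup>2 = c} \<noteq> {l. (norm (t *v w l))\<^sup>2 = c}"
        using i w(3) by (metis (mono_tags, lifting) less_irrefl mem_Collect_eq)
    qed
    hence "N v < N w" unfolding N_def by (intro psubset_card_mono) auto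
    with max[OF w(1)] show False by simp
  qed
  with v show thesis using that by (simp add: c_def)
qed

section \<open>Bloch form: traces, steerability and entropy\<close>

lemma pauli_dot_entries:
  "pauli_dot u $ 1 $ 1 = Complex (u $ 3) 0" "pauli_dot u $ 1 $ 2 = Complex (u $ 1) (- u $ 2)"
  "pauli_dot u $ 2 $ 1 = Complex (u $ 1) (u $ 2)" "pauli_dot u $ 2 $ 2 = Complex (- u $ 3) 0"
  by (simp_all add: pauli_dot_def sum_3 pauli_entries complex_eq_iff)

lemma bloch_op_entries:
  "bloch_op a b t $ (1, 1) $ (1, 1) = Complex ((1 + b $ 3 + a $ 3 + t $ 3 $ 3) / 4) 0"
  "bloch_op a b t $ (1, 1) $ (1, 2) = Complex ((b $ 1 + t $ 3 $ 1) / 4) ((- b $ 2 - t $ 3 $ 2) / 4)"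
  "bloch_op a b t $ (1, 1) $ (2, 1) = Complex ((a $ 1 + t $ 1 $ 3) / 4) ((- a $ 2 - t $ 2 $ 3) / 4)"
  "bloch_op a b t $ (1, 1) $ (2, 2) = Complex ((t $ 1 $ 1 - t $ 2 $ 2) / 4) ((- t $ 1 $ 2 - t $ 2 $ 1) / 4)"
  "bloch_op a b t $ (1, 2) $ (1, 1) = Complex ((b $ 1 + t $ 3 $ 1) / 4) ((b $ 2 + t $ 3 $ 2) / 4)"
  "bloch_op a b t $ (1, 2) $ (1, 2) = Complex ((1 + a $ 3 - b $ 3 - t $ 3 $ 3) / 4) 0"
  "bloch_op a b t $ (1, 2) $ (2, 1) = Complex ((t $ 1 $ 1 + t $ 2 $ 2) / 4) ((t $ 1 $ 2 - t $ 2 $ 1) / 4)"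
  "bloch_op a b t $ (1, 2) $ (2, 2) = Complex ((a $ 1 - t $ 1 $ 3) / 4) ((t $ 2 $ 3 - a $ 2) / 4)"
  "bloch_op a b t $ (2, 1) $ (1, 1) = Complex ((a $ 1 + t $ 1 $ 3) / 4) ((a $ 2 + t $ 2 $ 3) / 4)"
  "bloch_op a b t $ (2, 1) $ (1, 2) = Complex ((t $ 1 $ 1 + t $ 2 $ 2) / 4) ((t $ 2 $ 1 - t $ 1 $ 2) / 4)"
  "bloch_op a b t $ (2, 1) $ (2, 1) = Complex ((1 + b $ 3 - a $ 3 - t $ 3 $ 3) / 4) 0"
  "bloch_op a b t $ (2, 1) $ (2, 2) = Complex ((b $ 1 - t $ 3 $ 1) / 4) ((t $ 3 $ 2 - b $ 2) / 4)"
  "bloch_op a b t $ (2, 2) $ (1, 1) = Complex ((t $ 1 $ 1 - t $ 2 $ 2) / 4) ((t $ 1 $ 2 + t $ 2 $ 1) / 4)"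
  "bloch_op a b t $ (2, 2) $ (1, 2) = Complex ((a $ 1 - t $ 1 $ 3) / 4) ((a $ 2 - t $ 2 $ 3) / 4)"
  "bloch_op a b t $ (2, 2) $ (2, 1) = Complex ((b $ 1 - t $ 3 $ 1) / 4) ((b $ 2 - t $ 3 $ 2) / 4)"
  "bloch_op a b t $ (2, 2) $ (2, 2) = Complex ((1 + t $ 3 $ 3 - b $ 3 - a $ 3) / 4) 0"
  by (simp_all add: bloch_op_def tensor_op_def pauli_dot_entries sum_3 pauli_entries mat_def
      complex_eq_iff algebra_simps)

lemma trace_matrix_mult:
  fixes X Y :: "'a::semiring_1 ^ 'n ^ 'n"
  shows "trace (X ** Y) = (\<Sum>i\<in>UNIV. \<Sum>j\<in>UNIV. X $ i $ j * Y $ j $ i)"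
  by (simp add: trace_def matrix_matrix_mult_def)

text \<open>Pauli matrices are traceless and Tr(sigma_m sigma_n) is 2 if m = n and 0 otherwise, so
  only the \<open>t\<close> terms survive and their factor 2 * 2 cancels the 1/4. The proof verifies
  this entrywise.\<close>

lemma trace_bloch_op_tensor:
  "trace (bloch_op a b t ** (pauli_dot u \<otimes>\<^sub>q pauli_dot v)) = complex_of_real (u \<bullet> (t *v v))"
  by (simp add: trace_matrix_mult UNIV_22 bloch_op_entries tensor_op_def pauli_dot_entries
      complex_eq_iff inner_vec_def matrix_vector_mult_def sum_3) (simp add: field_simps)

lemma F3_bloch_op:
  "F3 (bloch_op a b t) u v = \<bar>\<Sum>l\<in>UNIV. u l \<bullet> (t *v v l)\<bar> / sqrt 3"
  by (simp add: F3_def trace_bloch_op_tensor flip: of_real_sum)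

lemma F3_steerable_bloch_op: "F3_steerable (bloch_op a b t) \<longleftrightarrow> 1 < (norm t)\<^sup>2"
proof
  assume "F3_steerable (bloch_op a b t)"
  then obtain u v where u: "\<And>l. norm (u l) = 1" and v: "orthonormal v"
    and F: "1 < F3 (bloch_op a b t) u v"
    unfolding F3_steerable_def orthonormal_def by blast
  have "sqrt 3 < \<bar>\<Sum>l\<in>UNIV. u l \<bullet> (t *v v l)\<bar>"
    using F by (simp add: F3_bloch_op less_divide_eq)
  also have "\<dots> \<le> (\<Sum>l\<in>UNIV. norm (t *v v l))"
    by (intro sum_abs[THEN order_trans] sum_mono) (metis Cauchy_Schwarz_ineq2 u mult_1)
  finally have "(sqrt 3)\<^sup>2 < (\<Sum>l\<in>UNIV. norm (t *v v l))\<^sup>2"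
    by (intro power_strict_mono) auto
  \<comment> \<open>Cauchy-Schwarz against the all-ones vector; its factor 3 cancels the square of
    \<open>sqrt 3\<close>.\<close>
  also have "\<dots> \<le> 3 * (\<Sum>l\<in>UNIV. (norm (t *v v l))\<^sup>2)"
    using sum_squared_le_sum_of_squares[of "\<lambda>l. norm (t *v v l)" UNIV]
    by (simp add: mult.commute)
  also have "\<dots> = 3 * (norm t)\<^sup>2" by (simp add: sum_norm_orthonormal[OF v])
  finally show "1 < (norm t)\<^sup>2" by simp
next
  assume t: "1 < (norm t)\<^sup>2"
  obtain v :: "3 \<Rightarrow> real ^ 3" where v: "orthonormal v"
    and eq: "\<And>l. (norm (t *v v l))\<^sup>2 = (norm t)\<^sup>2 / 3"
    using orthonormal_equal_norms[of t] by auto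
  have n: "norm (t *v v l) = norm t / sqrt 3" for l
  proof -
    have "(norm (t *v v l))\<^sup>2 = (norm t / sqrt 3)\<^sup>2" by (simp add: eq power_divide)
    thus ?thesis by (simp add: power2_eq_iff_nonneg)
  qed
  have pos: "1 < norm t" using t power2_less_imp_less[of 1 "norm t"] by simp
  \<comment> \<open>Aligning \<open>u l\<close> with \<open>t *v v l\<close> gives equality in
    Cauchy-Schwarz. Since \<open>sgn 0 = 0\<close>, these are unit vectors only because no image
    vanishes, which \<open>pos\<close> guarantees.\<close>
  define u where "u = (\<lambda>l. sgn (t *v v l))"
  have nz: "t *v v l \<noteq> 0" for l using n[of l] pos by auto
  hence u: "norm (u l) = 1" for l by (simp add: u_def norm_sgn)
  have "u l \<bullet> (t *v v l) = norm (t *v v l)" for l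
    using nz[of l] by (simp add: u_def sgn_div_norm dot_square_norm power2_eq_square)
  hence "F3 (bloch_op a b t) u v = norm t"
    by (simp add: F3_bloch_op n abs_mult)
  thus "F3_steerable (bloch_op a b t)"
    unfolding F3_steerable_def using u v pos unfolding orthonormal_def by metis
qed

text \<open>The sixteen products of Pauli matrices and identities are orthogonal for the trace inner
  product, each with squared norm 4; the prefactor contributes 1/16.\<close>

lemma purity_bloch_op:
  "Re (trace (bloch_op a b t ** bloch_op a b t)) =
    (1 + (norm a)\<^sup>2 + (norm b)\<^sup>2 + (norm t)\<^sup>2) / 4"
  by (simp add: trace_matrix_mult UNIV_22 bloch_op_entries norm_vec_square sum_3)
    (simp add: field_simps power2_eq_square)

text \<open>Tracing out A removes every term with a Pauli matrix on A and doubles the rest, leaving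
  half of the identity plus \<open>pauli_dot b\<close>.\<close>

lemma purity_ptrace_A_bloch_op:
  "Re (trace (ptrace_A (bloch_op a b t) ** ptrace_A (bloch_op a b t))) = (1 + (norm b)\<^sup>2) / 2"
  by (simp add: trace_def ptrace_A_def matrix_matrix_mult_def sum_2 bloch_op_entries
      norm_vec_square sum_3) (simp add: field_simps power2_eq_square)

lemma cond_renyi2_bloch_op:
  "cond_renyi2 (bloch_op a b t) =
    log 2 (2 * (1 + (norm b)\<^sup>2) / (1 + (norm a)\<^sup>2 + (norm b)\<^sup>2 + (norm t)\<^sup>2))"
proof -
  define B where "B = 1 + (norm b)\<^sup>2"
  define R where "R = 1 + (norm a)\<^sup>2 + (norm b)\<^sup>2 + (norm t)\<^sup>2"
  have "0 < B" "0 < R" unfolding B_def R_def by (auto intro!: add_pos_nonneg)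
  hence "- log 2 (R / 4) - - log 2 (B / 2) = log 2 ((B / 2) / (R / 4))"
    by (subst log_divide) auto
  also have "(B / 2) / (R / 4) = 2 * B / R" by simp
  finally show ?thesis
    by (simp add: cond_renyi2_def renyi2_def purity_bloch_op purity_ptrace_A_bloch_op B_def R_def)
qed

theorem theorem2:
  fixes \<rho> :: two_qubit_op and a b :: "real ^ 3" and t :: "real ^ 3 ^ 3"
  assumes "density_op \<rho>"
    and "\<rho> = bloch_op a b t"
  shows "F3_steerable \<rho> \<longleftrightarrow>
    cond_renyi2 \<rho> < log 2 ((1 + (norm b)\<^sup>2) / (1 + ((norm a)\<^sup>2 + (norm b)\<^sup>2) / 2))"
proof -
  define A B T where "A = (norm a)\<^sup>2" "B = (norm b)\<^sup>2" "T = (norm t)\<^sup>2"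
  have nn: "0 \<le> A" "0 \<le> B" "0 \<le> T" by (simp_all add: A_B_T_def)
  have pos: "0 < 2 * (1 + B)" "0 < 1 + A + B + T" "0 < 2 + A + B" using nn by auto
  have eq: "(1 + B) / (1 + (A + B) / 2) = 2 * (1 + B) / (2 + A + B)"
    using nn by (simp add: field_simps)
  have "cond_renyi2 \<rho> < log 2 ((1 + B) / (1 + (A + B) / 2)) \<longleftrightarrow>
      2 * (1 + B) / (1 + A + B + T) < 2 * (1 + B) / (2 + A + B)"
    unfolding assms(2) cond_renyi2_bloch_op A_B_T_def[symmetric] eq
    using pos by (intro log_less_cancel_iff divide_pos_pos) auto
  \<comment> \<open>The numerators agree and are positive, so the quotients compare inversely to
    their denominators; cancelling \<open>A\<close> and \<open>B\<close> leaves
    \<open>1 < T\<close>.\<close>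
  also have "\<dots> \<longleftrightarrow> 2 + A + B < 1 + A + B + T"
    using pos by (simp add: divide_less_eq less_divide_eq mult.commute)
  finally show ?thesis
    unfolding assms(2) F3_steerable_bloch_op A_B_T_def by simp
qed

end
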